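(* Let $(\mathbf{v},\mathbf{B})\in\mathcal{D}_n$ with $\mathbf{B}=(b_1,\ldots,b_n)$ and let $\mathbf{A}=(A_1,\ldots,A_n)\in(\mathbb{R}^{d\times d})^n$ be a tuple of symmetric positive-definite matrices. Suppose $\mathbf{X},\mathbf{Y}\in\mathbb{D}_n$ are such that $\{L_i^{\mathbf{A}}(\mathbf{X};\mathbf{v})\}_{i=1}^n$ and $\{L_i^{\mathbf{A}}(\mathbf{Y};\mathbf{v})\}_{i=1}^n$ are compatible with the data $(\mathbf{v},\mathbf{B})$ in the sense that $$c_i(\mathbf{X};\mathbf{v},\mathbf{A})=c_i(\mathbf{Y};\mathbf{v},\mathbf{A})=b_i\quad\forall\, i\in\{1,\ldots,n\}.$$ Then $$L_i^{\mathbf{A}}(\mathbf{X};\mathbf{v})=L_i^{\mathbf{A}}(\mathbf{Y};\mathbf{v})\quad\forall\, i\in\{1,\ldots,n\}.$$ In other words, an anisotropic Laguerre tessellation is uniquely determined by the volumes and centroids of its cells and its anisotropy matrices.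
   Context: Let $d\ge 2$ and let $\Omega\subset\mathbb{R}^d$ be a non-empty, convex, bounded set equal to the closure of its interior. For a Lebesgue-measurable $E\subseteq\mathbb{R}^d$, $\mathrm{vol}(E)$ is its $d$-dimensional Lebesgue measure and, if $\mathrm{vol}(E)\neq 0$, $\sigma(E)=\frac{1}{\mathrm{vol}(E)}\int_E x\,dx$ is its centroid. $\mathbb{D}_n=\{\mathbf{X}=(x_1,\ldots,x_n)\in(\mathbb{R}^d)^n : x_i\ne x_j \text{ for all } i\neq j\}$. $\mathbb{V}_n=\{\mathbf{v}=(v_1,\ldots,v_n)\in(0,\infty)^n : \sum_{i=1}^n v_i=\mathrm{vol}(\Omega)\}$, and $$\mathcal{D}_n=\Big\{(\mathbf{v},\mathbf{B})=((v_1,\ldots,v_n),(b_1,\ldots,b_n))\in\mathbb{V}_n\times\Omega^n : \sum_{i=1}^n v_ib_i=\mathrm{vol}(\Omega)\,\sigma(\Omega)\Big\}.$$ For a symmetric positive-definite matrix $A$, $|x|_A=(x\cdot Ax)^{1/2}$. For $\mathbf{X}\in\mathbb{D}_n$, $\mathbf{w}\in\mathbb{R}^n$ and a tuple $\mathbf{A}=(A_1,\ldots,A_n)$ of symmetric positive-definite $d\times d$ matrices, the $i$-th anisotropic Laguerre cell is $$\mathrm{Lag}_i^{\mathbf{A}}(\mathbf{X},\mathbf{w})=\{x\in\Omega : |x-x_i|_{A_i}^2-w_i\le|x-x_j|_{A_j}^2-w_j\ \forall j\in\{1,\ldots,n\}\}.$$ For $\mathbf{X}\in\mathbb{D}_n$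 and $\mathbf{v}\in\mathbb{V}_n$, let $\mathbf{w}^\star(\mathbf{X};\mathbf{v},\mathbf{A})\in\mathbb{R}^n$ denote a maximiser of the concave function $\mathbf{w}\mapsto\sum_{i=1}^n\int_{\mathrm{Lag}_i^{\mathbf{A}}(\mathbf{X},\mathbf{w})}(|x-x_i|_{A_i}^2-w_i)\,dx+\sum_{i=1}^n w_iv_i$ on $\mathbb{R}^n$. It is known that a maximiser exists and that $\mathrm{vol}(\mathrm{Lag}_i^{\mathbf{A}}(\mathbf{X},\mathbf{w}^\star(\mathbf{X};\mathbf{v},\mathbf{A})))=v_i$ for all $i$. Set $L_i^{\mathbf{A}}(\mathbf{X};\mathbf{v})=\mathrm{Lag}_i^{\mathbf{A}}(\mathbf{X},\mathbf{w}^\star(\mathbf{X};\mathbf{v},\mathbf{A}))$ (the $i$-th anisotropic Laguerre cell in the tessellation with seeds $\mathbf{X}$, cell volumes $\mathbf{v}$ and anisotropy matrices $\mathbf{A}$) and $c_i(\mathbf{X};\mathbf{v},\mathbf{A})=\sigma(L_i^{\mathbf{A}}(\mathbf{X};\mathbf{v}))$.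
   Formalization: Equality of the cells is proved up to Lebesgue-null sets, together with equality of their interiors; literal equality as point sets fails, since an anisotropic cell may contain extra null pieces, e.g. where it touches the boundary of Ω. *)

theory Defs
  imports "HOL-Analysis.Analysis"
begin

text \<open>
  Points of \<open>R^d\<close> have type \<^typ>\<open>real^'d\<close>, and an \<open>n\<close>-tuple is a vector whose index type
  \<open>'n\<close> is a finite type: seeds \<^typ>\<open>(real^'d)^'n\<close>, volumes and weights \<^typ>\<open>real^'n\<close>,
  anisotropy matrices \<^typ>\<open>(real^'d^'d)^'n\<close>.
\<close>

abbreviation vol :: "(real^'d) set \<Rightarrow> real" where
  "vol E \<equiv> measure lebesgue E"

definition centroid :: "(real^'d) set \<Rightarrow> real^'d" where
  "centroid E = (1 / vol E) *\<^sub>R (LINT x:E|lebesgue. x)"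

definition sym_pos_def :: "real^'d^'d \<Rightarrow> bool" where
  "sym_pos_def M \<longleftrightarrow> transpose M = M \<and> (\<forall>x. x \<noteq> 0 \<longrightarrow> x \<bullet> (M *v x) > 0)"

definition anorm :: "real^'d^'d \<Rightarrow> real^'d \<Rightarrow> real" where
  "anorm M x = sqrt (x \<bullet> (M *v x))"

definition seeds :: "((real^'d)^'n) set" where
  "seeds = {X. \<forall>i j. i \<noteq> j \<longrightarrow> X $ i \<noteq> X $ j}"

definition volumes :: "(real^'d) set \<Rightarrow> (real^'n) set" where
  "volumes \<Omega> = {v. (\<forall>i. v $ i > 0) \<and> (\<Sum>i\<in>UNIV. v $ i) = vol \<Omega>}"

definition admissible_data :: "(real^'d) set \<Rightarrow> ((real^'n) \<times> ((real^'d)^'n)) set" where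
  "admissible_data \<Omega> = {(v, B). v \<in> volumes \<Omega> \<and> (\<forall>i. B $ i \<in> \<Omega>) \<and>
     (\<Sum>i\<in>UNIV. v $ i *\<^sub>R B $ i) = vol \<Omega> *\<^sub>R centroid \<Omega>}"

text \<open>
  For anisotropic data a cell need not be the closure of its interior: lower-dimensional pieces can
  occur where one cell merely touches another, or touches the boundary of \<open>\<Omega>\<close>.
  Cells that agree up to a null set can therefore differ as point sets.
\<close>

definition Lag :: "(real^'d) set \<Rightarrow> (real^'d^'d)^'n \<Rightarrow> (real^'d)^'n \<Rightarrow> real^'n \<Rightarrow> 'n \<Rightarrow> (real^'d) set" where
  "Lag \<Omega> A X w i = {x \<in> \<Omega>. \<forall>j.
     (anorm (A $ i) (x - X $ i))\<^sup>2 - w $ i \<le> (anorm (A $ j) (x - X $ j))\<^sup>2 - w $ j}"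

definition dual_objective ::
  "(real^'d) set \<Rightarrow> (real^'d^'d)^'n \<Rightarrow> (real^'d)^'n \<Rightarrow> real^'n \<Rightarrow> real^'n \<Rightarrow> real" where
  "dual_objective \<Omega> A X v w =
     (\<Sum>i\<in>UNIV. LINT x:Lag \<Omega> A X w i|lebesgue. ((anorm (A $ i) (x - X $ i))\<^sup>2 - w $ i))
     + (\<Sum>i\<in>UNIV. w $ i * v $ i)"

text \<open>
  Maximisers are never unique (adding a constant to all weights changes nothing), so
  \<open>w\<^sup>\<star>(X; v, A)\<close> is rendered as a predicate rather than by a choice operator.
  Results are to be stated for every maximiser.
\<close>

definition optimal_weights ::
  "(real^'d) set \<Rightarrow> (real^'d^'d)^'n \<Rightarrow> (real^'d)^'n \<Rightarrow> real^'n \<Rightarrow> real^'n \<Rightarrow> bool" where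
  "optimal_weights \<Omega> A X v w \<longleftrightarrow> is_arg_max (dual_objective \<Omega> A X v) (\<lambda>_. True) w"

end

theory Submission
  imports Defs
begin

text \<open>
  On its \<open>i\<close>-th cell the tessellation for \<open>X\<close> realises the minimum of the potentials
  \<open>f j x = (anorm (A $ j) (x - X $ j))\<^sup>2 - wX $ j\<close>, so assigning the mass of \<open>\<Omega>\<close> to the cells of
  any other tessellation costs at least as much; likewise for the potentials \<open>g\<close> of \<open>Y\<close>.  Since the
  matrices agree, \<open>f i - g i\<close> is affine, so its integral over a cell depends only on the volume and
  the centroid of the cell.  Adding the two cost inequalities therefore gives equality, and
  equality forces the cells to agree up to null sets.  That the cell volumes are \<open>v\<close> is the
  first-order condition for the maximiser, once overlaps of cells are known to be null.
\<close>

section \<open>Zero sets of quadratic functions\<close>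

text \<open>
  A point lies in at most \<open>k\<close> of the translates of \<open>S\<close> along \<open>u\<close>, so arbitrarily many translates
  of a bounded piece of \<open>S\<close> have total measure at most \<open>k\<close> times that of a fixed ball.
\<close>

lemma negligible_if_finite_on_lines:
  fixes S :: "'a::euclidean_space set" and u :: 'a
  assumes S: "S \<in> sets lebesgue"
    and fin: "\<And>x. finite {t::real. x + t *\<^sub>R u \<in> S}"
    and card: "\<And>x. card {t::real. x + t *\<^sub>R u \<in> S} \<le> k"
  shows "negligible S"
proof (subst negligible_on_intervals, intro allI)
  fix a b :: 'a
  define T where "T = S \<inter> cbox a b"
  have T: "T \<in> lmeasurable"
    unfolding T_def using S by (metis fmeasurable_Int_fmeasurable Int_commute lmeasurable_cbox)
  obtain r where r: "\<And>x. x \<in> T \<Longrightarrow> norm x \<le> r"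
    using bounded_subset[OF bounded_cbox, of T a b] unfolding T_def bounded_iff by blast
  define K :: "'a set" where "K = cball 0 (r + norm u)"
  \<comment> \<open>Infinitely many distinct shifts are needed, all in the unit interval: every
    translate of \<open>T\<close> then stays in the one ball \<open>K\<close> of radius
    \<open>r + norm u\<close>.\<close>
  define s where "s = (\<lambda>j::nat. inverse (real (Suc j)))"
  define Tr where "Tr = (\<lambda>j. (+) (- s j *\<^sub>R u) ` T)"
  have s: "0 \<le> s j" "s j \<le> 1" for j
    by (auto simp: s_def inverse_le_1_iff)
  have inj: "inj s"
    by (auto simp: inj_on_def s_def)
  have mem: "x \<in> Tr j \<longleftrightarrow> x + s j *\<^sub>R u \<in> T" for x j
  proof
    assume "x + s j *\<^sub>R u \<in> T"
    then have "- s j *\<^sub>R u + (x + s j *\<^sub>R u) \<in> Tr j"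
      unfolding Tr_def by blast
    then show "x \<in> Tr j" by simp
  qed (auto simp: Tr_def)
  have Tr: "Tr j \<in> lmeasurable" for j
    unfolding Tr_def by (rule measurable_translation[OF T])
  have K: "K \<in> lmeasurable"
    by (simp add: K_def)
  have int: "integrable lebesgue (indicat_real E)" if "E \<in> lmeasurable" for E :: "'a set"
    using that by (intro integrable_real_indicator) (auto simp: fmeasurable_def)
  have sub: "Tr j \<subseteq> K" for j
  proof
    fix x assume "x \<in> Tr j"
    then have "norm (x + s j *\<^sub>R u) \<le> r" by (simp add: mem r)
    moreover have "norm x \<le> norm (x + s j *\<^sub>R u) + norm (s j *\<^sub>R u)"
      by (metis add_diff_cancel norm_triangle_ineq4)
    moreover have "norm (s j *\<^sub>R u) \<le> norm u"
      using s[of j] by (simp add: mult_left_le_one_le)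
    ultimately show "x \<in> K" by (simp add: K_def)
  qed
  have bound: "real N * measure lebesgue T \<le> real k * measure lebesgue K" for N
  proof -
    have le: "(\<Sum>j<N. indicat_real (Tr j) x) \<le> real k * indicat_real K x" for x
    proof (cases "x \<in> K")
      case True
      have "(\<Sum>j<N. indicat_real (Tr j) x) = real (card {j. j < N \<and> x \<in> Tr j})"
        by (simp add: indicator_def sum.If_cases Int_def conj_commute)
      \<comment> \<open>Distinct indices give distinct parameters \<open>s j\<close> on the line
        through \<open>x\<close>, so the number of translates containing \<open>x\<close> is bounded
        by the number of hits of that line in \<open>S\<close>.\<close>
      also have "card {j. j < N \<and> x \<in> Tr j} = card (s ` {j. j < N \<and> x \<in> Tr j})"
        using inj by (simp add: card_image inj_on_subset)
      also have "\<dots> \<le> card {t. x + t *\<^sub>R u \<in> S}"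
        by (rule card_mono[OF fin]) (auto simp: mem T_def)
      also have "\<dots> \<le> k" by (rule card)
      finally show ?thesis using True by simp
    next
      case False
      then have "x \<notin> Tr j" for j using sub by blast
      then show ?thesis by simp
    qed
    have "real N * measure lebesgue T = (\<Sum>j<N. measure lebesgue (Tr j))"
      using measure_translation[of "- s _ *\<^sub>R u" T] by (simp only: Tr_def) simp
    also have "\<dots> = (\<Sum>j<N. integral\<^sup>L lebesgue (indicat_real (Tr j)))"
      by simp
    also have "\<dots> = (LINT x|lebesgue. (\<Sum>j<N. indicat_real (Tr j) x))"
      by (intro Bochner_Integration.integral_sum[symmetric] int Tr)
    also have "\<dots> \<le> (LINT x|lebesgue. real k * indicat_real K x)"
      by (intro integral_mono Bochner_Integration.integrable_sum integrable_mult_right int Tr K le)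
    also have "\<dots> = real k * measure lebesgue K" by simp
    finally show ?thesis .
  qed
  have "measure lebesgue T = 0"
  proof (rule ccontr)
    assume "measure lebesgue T \<noteq> 0"
    then have "measure lebesgue T > 0" by (simp add: zero_less_measure_iff)
    from reals_Archimedean3[OF this] bound show False by (meson not_less)
  qed
  then show "negligible (S \<inter> cbox a b)"
    using T by (simp add: negligible_iff_measure0 T_def)
qed

lemma roots_quadratic:
  fixes a b c :: real
  assumes "a \<noteq> 0"
  shows "finite {t. a * t\<^sup>2 + b * t + c = 0}" "card {t. a * t\<^sup>2 + b * t + c = 0} \<le> 2"
proof -
  let ?p = "[:c, b, a:]"
  have eq: "{t. a * t\<^sup>2 + b * t + c = 0} = {t. poly ?p t = 0}"
    by (simp add: algebra_simps power2_eq_square)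
  have "?p \<noteq> 0" using assms by simp
  from poly_roots_finite[OF this] card_poly_roots_bound[OF this]
  show "finite {t. a * t\<^sup>2 + b * t + c = 0}" "card {t. a * t\<^sup>2 + b * t + c = 0} \<le> 2"
    unfolding eq using assms by simp_all
qed

section \<open>Anisotropic norms and their bisectors\<close>

lemma sym_inner_matrix:
  fixes M :: "real^'d^'d"
  assumes "transpose M = M"
  shows "x \<bullet> (M *v y) = y \<bullet> (M *v x)"
  by (metis assms dot_lmul_matrix inner_commute transpose_matrix_vector)

lemma anorm_power2:
  assumes "sym_pos_def M"
  shows "(anorm M x)\<^sup>2 = x \<bullet> (M *v x)"
proof -
  have "x \<bullet> (M *v x) \<ge> 0"
    using assms by (cases "x = 0") (auto simp: sym_pos_def_def less_imp_le)
  then show ?thesis by (simp add: anorm_def)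
qed

text \<open>Isolates the part quadratic in \<open>x\<close>, which does not involve
  \<open>p\<close>: it cancels when two such expressions with the same matrix are subtracted,
  leaving an affine function of \<open>x\<close>.\<close>

lemma anorm_diff_power2:
  assumes "sym_pos_def M"
  shows "(anorm M (x - p))\<^sup>2 = x \<bullet> (M *v x) - 2 * (x \<bullet> (M *v p)) + p \<bullet> (M *v p)"
  using assms sym_inner_matrix[of M x p]
  by (simp add: anorm_power2 sym_pos_def_def matrix_vector_mult_diff_distrib inner_diff_left
      inner_diff_right)

text \<open>The leading coefficient in \<open>t\<close> depends on the direction \<open>u\<close>
  only, not on the base point, so one \<open>u\<close> serves all parallel lines.\<close>

lemma anorm_add_scaleR_power2:
  assumes "sym_pos_def M"
  shows "(anorm M (x + t *\<^sub>R u))\<^sup>2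
    = (u \<bullet> (M *v u)) * t\<^sup>2 + 2 * (x \<bullet> (M *v u)) * t + x \<bullet> (M *v x)"
  unfolding anorm_power2[OF assms] using assms sym_inner_matrix[of M x u]
  by (simp add: sym_pos_def_def matrix_vector_right_distrib
      matrix_vector_mult_scaleR inner_add_left inner_add_right power2_eq_square algebra_simps)

lemma continuous_on_anorm_power2:
  assumes "sym_pos_def M"
  shows "continuous_on S (\<lambda>x. (anorm M (x - p))\<^sup>2)"
  unfolding anorm_power2[OF assms]
  by (intro continuous_intros matrix_vector_mult_linear_continuous_on
      continuous_on_compose2[OF matrix_vector_mult_linear_continuous_on[of UNIV]]) auto

text \<open>If the two quadratic forms agree, the bisector is a hyperplane, because \<open>p\<close>
  and \<open>q\<close> differ. Otherwise the forms differ in some direction \<open>u\<close>, and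
  each line parallel to \<open>u\<close> meets the bisector in the roots of a genuine quadratic,
  hence at most twice.\<close>

lemma negligible_anisotropic_bisector:
  fixes M N :: "real^'d^'d"
  assumes M: "sym_pos_def M" and N: "sym_pos_def N" and "p \<noteq> q"
  shows "negligible {x. (anorm M (x - p))\<^sup>2 - a = (anorm N (x - q))\<^sup>2 - b}" (is "negligible ?Z")
proof (cases "\<forall>u. u \<bullet> (M *v u) = u \<bullet> (N *v u)")
  case True
  \<comment> \<open>Half the normal vector of the hyperplane; testing it against
    \<open>q - p\<close> shows by positive definiteness that it is nonzero.\<close>
  define e where "e = M *v (q - p)"
  have "(q - p) \<bullet> e > 0"
    using M \<open>p \<noteq> q\<close> by (simp add: e_def sym_pos_def_def)
  then have "2 *\<^sub>R e \<noteq> 0" by auto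
  moreover have "?Z = {x. (2 *\<^sub>R e) \<bullet> x = a - b + q \<bullet> (M *v q) - p \<bullet> (M *v p)}"
  proof -
    have "(anorm N (x - q))\<^sup>2 = (anorm M (x - q))\<^sup>2" for x
      using True by (simp add: anorm_power2 M N)
    moreover have "e \<bullet> x = x \<bullet> (M *v q) - x \<bullet> (M *v p)" for x
      by (simp add: e_def matrix_vector_mult_diff_distrib inner_diff_left inner_diff_right inner_commute)
    ultimately show ?thesis
      by (auto simp: anorm_diff_power2 M)
  qed
  ultimately show ?thesis
    using negligible_hyperplane by metis
next
  case False
  then obtain u where u: "u \<bullet> (M *v u) - u \<bullet> (N *v u) \<noteq> 0" by auto
  have "closed ?Z"
    by (intro closed_Collect_eq continuous_on_diff continuous_on_anorm_power2 M N continuous_on_const)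
  then have "?Z \<in> sets lebesgue" by simp
  then show ?thesis
  proof (rule negligible_if_finite_on_lines[where u = u and k = 2])
    fix x
    define \<beta> \<gamma> where "\<beta> = 2 * ((x - p) \<bullet> (M *v u)) - 2 * ((x - q) \<bullet> (N *v u))"
      and "\<gamma> = (x - p) \<bullet> (M *v (x - p)) - a - (x - q) \<bullet> (N *v (x - q)) + b"
    have shift: "x + t *\<^sub>R u - y = (x - y) + t *\<^sub>R u" for t y by simp
    have "{t. x + t *\<^sub>R u \<in> ?Z} = {t. (u \<bullet> (M *v u) - u \<bullet> (N *v u)) * t\<^sup>2 + \<beta> * t + \<gamma> = 0}"
      unfolding mem_Collect_eq shift anorm_add_scaleR_power2[OF M] anorm_add_scaleR_power2[OF N]
        \<beta>_def \<gamma>_def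
      by (intro Collect_cong) (auto simp only: algebra_simps)
    with roots_quadratic[OF u]
    show "finite {t. x + t *\<^sub>R u \<in> ?Z}" "card {t. x + t *\<^sub>R u \<in> ?Z} \<le> 2" by simp_all
  qed
qed

section \<open>Minimisation diagrams\<close>

definition cell :: "'a set \<Rightarrow> ('n::finite \<Rightarrow> 'a \<Rightarrow> real) \<Rightarrow> 'n \<Rightarrow> 'a set" where
  "cell S f i = {x \<in> S. \<forall>j. f i x \<le> f j x}"

definition lower_env :: "('n::finite \<Rightarrow> 'a \<Rightarrow> real) \<Rightarrow> 'a \<Rightarrow> real" where
  "lower_env f x = Min (range (\<lambda>i. f i x))"

lemma lower_env_le: "lower_env f x \<le> f i x"
  by (simp add: lower_env_def)

lemma lower_env_attained: obtains i where "lower_env f x = f i x"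
proof -
  have "lower_env f x \<in> range (\<lambda>i. f i x)"
    unfolding lower_env_def by (rule Min_in) auto
  then show thesis using that by blast
qed

lemma cell_eq: "cell S f i = {x \<in> S. f i x = lower_env f x}"
proof -
  have "(\<forall>j. f i x \<le> f j x) \<longleftrightarrow> f i x = lower_env f x" for x
    by (metis antisym lower_env_attained lower_env_le)
  then show ?thesis by (simp add: cell_def)
qed

lemma cell_subset: "cell S f i \<subseteq> S"
  by (auto simp: cell_def)

lemma Union_cell: "(\<Union>i. cell S f i) = S"
  unfolding cell_eq by (auto intro: lower_env_attained[of f] dest: sym)

lemma compact_cell:
  fixes f :: "'n::finite \<Rightarrow> 'a::t2_space \<Rightarrow> real"
  assumes "compact S" and "\<And>i. continuous_on S (f i)"
  shows "compact (cell S f i)"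
proof -
  have "closedin (top_of_set S) {x \<in> S. f i x - f j x \<in> {..0}}" for j
    by (intro continuous_closedin_preimage[unfolded vimage_def Int_def mem_Collect_eq] continuous_on_diff assms) auto
  then have "closedin (top_of_set S) (\<Inter>j. {x \<in> S. f i x - f j x \<in> {..0}})"
    by (intro closedin_INT) auto
  moreover have "(\<Inter>j. {x \<in> S. f i x - f j x \<in> {..0}}) = cell S f i"
    by (auto simp: cell_def)
  ultimately show ?thesis
    using assms(1) closedin_compact by metis
qed

lemma set_integrable_continuous_compact:
  fixes f :: "'a::euclidean_space \<Rightarrow> 'b::{banach, second_countable_topology}"
  assumes "compact S" "continuous_on S f"
  shows "set_integrable lebesgue S f"
proof -
  have "integrable lborel (\<lambda>x. indicator S x *\<^sub>R f x)"
    by (rule borel_integrable_compact[OF assms])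
  then show ?thesis
    unfolding set_integrable_def by (subst integrable_completion) auto
qed

text \<open>Ties put a point into several cells. This keeps the cells compact, while
  \<open>null\<close> makes them a partition of \<open>S\<close> up to null sets.\<close>

locale min_diagram =
  fixes S :: "'a::euclidean_space set" and f :: "'n::finite \<Rightarrow> 'a \<Rightarrow> real"
  assumes compact: "compact S"
    and cont: "\<And>i. continuous_on S (f i)"
    and null: "\<And>i j. i \<noteq> j \<Longrightarrow> negligible (cell S f i \<inter> cell S f j)"
begin

lemma lmeasurable_cell: "cell S f i \<in> lmeasurable"
  by (intro lmeasurable_compact compact_cell compact cont)

lemma integrable_cell:
  fixes h :: "'a \<Rightarrow> 'b::{banach, second_countable_topology}"
  assumes "continuous_on S h"
  shows "set_integrable lebesgue (cell S f i) h"
  by (meson assms cell_subset compact compact_cell cont continuous_on_subset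
      set_integrable_continuous_compact)

text \<open>On each cell the envelope coincides with a continuous potential, and finitely many cells
  cover \<open>S\<close>.\<close>

lemma integrable_lower_env: "set_integrable lebesgue S (lower_env f)"
proof -
  have "set_integrable lebesgue (cell S f i) (lower_env f)" for i
    using integrable_cell[OF cont, of i i]
    by (rule set_integrable_cong[THEN iffD1, rotated 3]) (auto simp: cell_eq)
  then have "set_integrable lebesgue (\<Union>i. cell S f i) (lower_env f)"
    using lmeasurable_cell by (intro set_integrable_UN) (auto simp: fmeasurable_def)
  then show ?thesis by (simp add: Union_cell)
qed

lemma sum_measure_cell: "(\<Sum>i\<in>UNIV. measure lebesgue (cell S f i)) = measure lebesgue S"
  using measure_negligible_finite_Union_image[of UNIV "cell S f"] lmeasurable_cell null
  by (simp add: pairwise_def Union_cell)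

lemma sum_integral_cell:
  fixes h :: "'a \<Rightarrow> 'b::{banach, second_countable_topology}"
  assumes "set_integrable lebesgue S h"
  shows "(\<Sum>i\<in>UNIV. LINT x:cell S f i|lebesgue. h x) = (LINT x:S|lebesgue. h x)"
proof -
  have *: "AE x in lebesgue. x \<in> cell S f i \<and> x \<in> cell S f j \<longrightarrow> i = j" for i j
  proof (cases "i = j")
    case False
    then show ?thesis
      using null[OF False] unfolding negligible_iff_null_sets
      by (auto dest: AE_not_in)
  qed simp
  have "set_integrable lebesgue (cell S f i) h" for i
    using assms fmeasurableD[OF lmeasurable_cell] cell_subset by (rule set_integrable_subset)
  then have "(LINT x:(\<Union>i. cell S f i)|lebesgue. h x) = (\<Sum>i\<in>UNIV. LINT x:cell S f i|lebesgue. h x)"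
    using * lmeasurable_cell by (intro set_integral_finite_UN_AE) auto
  then show ?thesis by (simp add: Union_cell)
qed

text \<open>Turns the total cost into one integral over the fixed set \<open>S\<close>, so that
  costs for different weights can be compared pointwise.\<close>

lemma sum_integral_cell_potential:
  "(\<Sum>i\<in>UNIV. LINT x:cell S f i|lebesgue. f i x) = (LINT x:S|lebesgue. lower_env f x)"
proof -
  have "(LINT x:cell S f i|lebesgue. f i x) = (LINT x:cell S f i|lebesgue. lower_env f x)" for i
    using lmeasurable_cell by (intro set_lebesgue_integral_cong) (auto simp: cell_eq)
  then show ?thesis by (simp add: sum_integral_cell integrable_lower_env)
qed

end

text \<open>
  Lowering the \<open>k\<close>-th potential by \<open>t\<close> costs at most \<open>t\<close> times the volume of the enlarged \<open>k\<close>-th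
  cell, so optimality gives \<open>v $ k \<le> vol\<close> of that cell; now let \<open>t\<close> tend to \<open>0\<close>.  Since the volumes
  and the \<open>v $ k\<close> have the same sum, all these inequalities are equalities.
\<close>

lemma measure_cell_optimal:
  fixes p :: "'n::finite \<Rightarrow> 'a::euclidean_space \<Rightarrow> real" and v w :: "real^'n"
  defines "q \<equiv> (\<lambda>w i x. p i x - w $ i)"
  assumes md: "\<And>w. min_diagram S (q w)"
    and sum_v: "(\<Sum>i\<in>UNIV. v $ i) = measure lebesgue S"
    and opt: "\<And>w'. (\<Sum>i\<in>UNIV. LINT x:cell S (q w') i|lebesgue. q w' i x) + (\<Sum>i\<in>UNIV. w' $ i * v $ i)
      \<le> (\<Sum>i\<in>UNIV. LINT x:cell S (q w) i|lebesgue. q w i x) + (\<Sum>i\<in>UNIV. w $ i * v $ i)"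
  shows "measure lebesgue (cell S (q w) k) = v $ k"
proof -
  note env = min_diagram.sum_integral_cell_potential[OF md]
  have le: "v $ k \<le> measure lebesgue (cell S (q w) k)" for k
  proof -
    define w' where "w' = (\<lambda>t. w + t *\<^sub>R axis k 1)"
    have w': "w' t $ i = w $ i + (if i = k then t else 0)" for t i
      by (simp add: w'_def axis_def)
    define C where "C = (\<lambda>t. cell S (q (w' t)) k)"
    have C: "C t \<in> lmeasurable" for t
      unfolding C_def by (rule min_diagram.lmeasurable_cell[OF md])
    have step: "v $ k \<le> measure lebesgue (C t)" if "t > 0" for t
    proof -
      have "set_integrable lebesgue (C t) (\<lambda>_. t)"
        unfolding C_def by (intro min_diagram.integrable_cell[OF md] continuous_on_const)
      then have int: "set_integrable lebesgue S (\<lambda>x. t * indicat_real (C t) x)"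
        using C[of t] cell_subset[of S "q (w' t)" k]
        by (simp add: set_integrable_def indicator_inter_arith[symmetric] C_def Int_absorb1
            mult.left_commute mult.commute)
      have intC: "(LINT x:S|lebesgue. t * indicat_real (C t) x) = t * measure lebesgue (C t)"
      proof -
        have "(LINT x:S|lebesgue. t * indicat_real (C t) x) = (LINT x|lebesgue. t * indicat_real (C t) x)"
          unfolding set_lebesgue_integral_def
          by (rule Bochner_Integration.integral_cong)
             (use cell_subset[of S "q (w' t)" k] in \<open>auto simp: C_def indicator_def\<close>)
        then show ?thesis by simp
      qed
      \<comment> \<open>The envelope can drop only where the lowered \<open>k\<close>-th potential
        becomes minimal, that is on \<open>C t\<close>, and there by at most
        \<open>t\<close>.\<close>
      have pt: "lower_env (q w) x - t * indicat_real (C t) x \<le> lower_env (q (w' t)) x" if "x \<in> S" for x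
      proof -
        obtain i where i: "lower_env (q (w' t)) x = q (w' t) i x" by (rule lower_env_attained)
        show ?thesis
        proof (cases "i = k")
          case True
          then have "x \<in> C t" using i \<open>x \<in> S\<close> by (simp add: C_def cell_eq)
          then show ?thesis
            using lower_env_le[of "q w" x k] i True by (simp add: q_def w')
        next
          case False
          then show ?thesis
            using lower_env_le[of "q w" x i] i \<open>t > 0\<close> by (simp add: q_def w' indicator_def)
        qed
      qed
      have "(LINT x:S|lebesgue. lower_env (q w) x) - t * measure lebesgue (C t)
          = (LINT x:S|lebesgue. lower_env (q w) x - t * indicat_real (C t) x)"
        by (simp only: set_integral_diff(2)[OF min_diagram.integrable_lower_env[OF md] int] intC)
      also have "\<dots> \<le> (LINT x:S|lebesgue. lower_env (q (w' t)) x)"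
        using pt by (intro set_integral_mono set_integral_diff(1) min_diagram.integrable_lower_env[OF md] int)
      finally have "(LINT x:S|lebesgue. lower_env (q w) x) - t * measure lebesgue (C t)
          \<le> (LINT x:S|lebesgue. lower_env (q (w' t)) x)" .
      moreover have "(\<Sum>i\<in>UNIV. w' t $ i * v $ i) = (\<Sum>i\<in>UNIV. w $ i * v $ i) + t * v $ k"
        by (simp add: w' distrib_right sum.distrib if_distrib[of "\<lambda>s. s * _"] cong: if_cong)
      ultimately have "t * v $ k \<le> t * measure lebesgue (C t)"
        using opt[of "w' t"] unfolding env by linarith
      then show ?thesis using \<open>t > 0\<close> by simp
    qed
    define D where "D = (\<lambda>n::nat. C (inverse (real (Suc n))))"
    \<comment> \<open>\<open>C t\<close> is the original cell with slack \<open>t\<close> in its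
      inequalities. Hence it shrinks as \<open>t\<close> decreases to 0, with intersection the
      original cell, and continuity of the measure from above applies.\<close>
    have C_iff: "x \<in> C t \<longleftrightarrow> x \<in> S \<and> (\<forall>j. j \<noteq> k \<longrightarrow> q w k x - q w j x \<le> t)" for x t
      by (auto simp: C_def cell_def q_def w' algebra_simps)
    have "decseq D"
    proof (rule decseq_SucI)
      fix n
      have "inverse (real (Suc (Suc n))) \<le> inverse (real (Suc n))" by (simp add: le_imp_inverse_le)
      then show "D (Suc n) \<subseteq> D n" unfolding D_def by (meson C_iff order_trans subsetI)
    qed
    moreover have "(\<Inter>n. D n) = cell S (q w) k"
    proof (intro equalityI subsetI)
      fix x assume x: "x \<in> (\<Inter>n. D n)"
      have "q w k x - q w j x \<le> 0" if "j \<noteq> k" for j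
      proof (rule LIMSEQ_le_const[OF LIMSEQ_inverse_real_of_nat])
        show "\<exists>N. \<forall>n\<ge>N. q w k x - q w j x \<le> inverse (real (Suc n))"
          using x that by (auto simp: D_def C_iff)
      qed
      then show "x \<in> cell S (q w) k"
        using x by (force simp: D_def C_iff cell_def)
    next
      fix x assume "x \<in> cell S (q w) k"
      then show "x \<in> (\<Inter>n. D n)"
        by (auto simp: D_def C_iff cell_def intro: order_trans[of _ 0])
    qed
    moreover have "range D \<subseteq> sets lebesgue"
      using C by (auto simp only: D_def dest: fmeasurableD)
    moreover have "emeasure lebesgue (D n) \<noteq> \<infinity>" for n
      using fmeasurableD2[OF C] by (simp only: D_def) simp
    ultimately have "(\<lambda>n. measure lebesgue (D n)) \<longlonglongrightarrow> measure lebesgue (cell S (q w) k)"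
      using Lim_measure_decseq[of D lebesgue] by metis
    then show ?thesis
      by (rule LIMSEQ_le_const) (auto simp: D_def intro!: step)
  qed
  have "(\<Sum>i\<in>UNIV. measure lebesgue (cell S (q w) i) - v $ i) = 0"
    by (simp add: sum_subtractf sum_v min_diagram.sum_measure_cell[OF md])
  then have "\<forall>i\<in>UNIV. measure lebesgue (cell S (q w) i) - v $ i = 0"
    by (subst (asm) sum_nonneg_eq_0_iff) (auto simp: le)
  then show ?thesis by simp
qed

section \<open>Comparison of two diagrams\<close>

lemma cells_subset_negligible:
  fixes f g :: "'n::finite \<Rightarrow> 'a::euclidean_space \<Rightarrow> real"
  assumes "min_diagram S f" and "min_diagram S g"
    and eq: "\<And>i. (LINT x:cell S f i|lebesgue. f i x - g i x) = (LINT x:cell S g i|lebesgue. f i x - g i x)"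
  shows "negligible (cell S g i - cell S f i)"
proof -
  interpret F: min_diagram S f by fact
  interpret G: min_diagram S g by fact
  have int_env: "set_integrable lebesgue (cell S g i) (lower_env f)"
    "set_integrable lebesgue (cell S f i) (lower_env g)" for i
    by (rule set_integrable_subset[OF F.integrable_lower_env fmeasurableD[OF G.lmeasurable_cell] cell_subset],
        rule set_integrable_subset[OF G.integrable_lower_env fmeasurableD[OF F.lmeasurable_cell] cell_subset])
  note ints = F.integrable_cell[OF F.cont] F.integrable_cell[OF G.cont]
    G.integrable_cell[OF F.cont] G.integrable_cell[OF G.cont]
  \<comment> \<open>The excess cost, measured by \<open>f\<close>, of using the \<open>i\<close>-th
    cell of \<open>g\<close>. It is nonnegative, and it vanishes only if almost every point of that
    cell also lies in the \<open>i\<close>-th cell of \<open>f\<close>.\<close>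
  define a where "a = (\<lambda>i. LINT x:cell S g i|lebesgue. f i x - lower_env f x)"
  have a_nonneg: "a i \<ge> 0" for i
    unfolding a_def set_lebesgue_integral_def
    by (intro Bochner_Integration.integral_nonneg) (auto simp: lower_env_le)
  have "(\<Sum>i\<in>UNIV. LINT x:cell S g i|lebesgue. g i x) \<le> (\<Sum>i\<in>UNIV. LINT x:cell S f i|lebesgue. g i x)"
  proof -
    have "(LINT x:cell S f i|lebesgue. lower_env g x) \<le> (LINT x:cell S f i|lebesgue. g i x)" for i
      by (intro set_integral_mono int_env ints lower_env_le)
    then show ?thesis
      unfolding G.sum_integral_cell_potential F.sum_integral_cell[OF G.integrable_lower_env, symmetric]
      by (intro sum_mono)
  qed
  moreover have "(\<Sum>i\<in>UNIV. a i)
      = (\<Sum>i\<in>UNIV. LINT x:cell S g i|lebesgue. f i x) - (\<Sum>i\<in>UNIV. LINT x:cell S f i|lebesgue. f i x)"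
    unfolding F.sum_integral_cell_potential G.sum_integral_cell[OF F.integrable_lower_env, symmetric] a_def
    by (simp add: set_integral_diff(2)[OF ints(3) int_env(1)] sum_subtractf)
  moreover have "(\<Sum>i\<in>UNIV. LINT x:cell S f i|lebesgue. f i x) - (\<Sum>i\<in>UNIV. LINT x:cell S f i|lebesgue. g i x)
     = (\<Sum>i\<in>UNIV. LINT x:cell S g i|lebesgue. f i x) - (\<Sum>i\<in>UNIV. LINT x:cell S g i|lebesgue. g i x)"
    using eq by (simp add: set_integral_diff(2)[OF ints(1,2)] set_integral_diff(2)[OF ints(3,4)] flip: sum_subtractf)
  \<comment> \<open>By the exchange identity from \<open>eq\<close>, the total excess for
    \<open>f\<close> equals the \<open>g\<close>-cost of the cells of \<open>g\<close> minus that of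
    the cells of \<open>f\<close>. This is at most 0 because the cells of \<open>g\<close> are
    optimal for \<open>g\<close>.\<close>
  ultimately have "(\<Sum>i\<in>UNIV. a i) \<le> 0" by linarith
  then have "a i = 0"
    using a_nonneg by (metis UNIV_I finite order_antisym sum_nonneg sum_nonneg_eq_0_iff)
  moreover have "set_integrable lebesgue (cell S g i) (\<lambda>x. f i x - lower_env f x)"
    by (intro set_integral_diff(1) ints int_env)
  ultimately have "AE x in lebesgue. indicator (cell S g i) x *\<^sub>R (f i x - lower_env f x) = 0"
    unfolding a_def set_lebesgue_integral_def set_integrable_def
    by (subst (asm) integral_nonneg_eq_0_iff_AE) (auto simp: lower_env_le)
  then have "AE x in lebesgue. x \<notin> cell S g i - cell S f i"
    by eventually_elim (auto simp: cell_eq)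
  moreover have "cell S g i - cell S f i \<in> sets lebesgue"
    using F.lmeasurable_cell G.lmeasurable_cell by auto
  ultimately show ?thesis
    by (simp add: negligible_iff_null_sets AE_iff_null_sets)
qed

text \<open>The hypothesis on the integrals survives swapping \<open>f\<close> and \<open>g\<close>,
  since both sides only change sign; so the one-sided result applies in both directions.\<close>

lemma cells_negligible_sym_diff:
  fixes f g :: "'n::finite \<Rightarrow> 'a::euclidean_space \<Rightarrow> real"
  assumes "min_diagram S f" and "min_diagram S g"
    and eq: "\<And>i. (LINT x:cell S f i|lebesgue. f i x - g i x) = (LINT x:cell S g i|lebesgue. f i x - g i x)"
  shows "negligible (sym_diff (cell S f i) (cell S g i))"
proof -
  have "(LINT x:T|lebesgue. g i x - f i x) = - (LINT x:T|lebesgue. f i x - g i x)" for T i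
    by (simp add: set_lebesgue_integral_def algebra_simps flip: Bochner_Integration.integral_minus)
  then have "(LINT x:cell S g i|lebesgue. g i x - f i x) = (LINT x:cell S f i|lebesgue. g i x - f i x)" for i
    by (simp only: eq)
  with assms show ?thesis
    by (intro negligible_Un cells_subset_negligible) auto
qed

section \<open>Interiors, and integrals of affine functions\<close>

text \<open>As \<open>T\<close> is closed, the part of the interior of \<open>S\<close> outside
  \<open>T\<close> is open; being null, it is empty.\<close>

lemma interior_subset_if_negligible_diff:
  fixes S T :: "'a::euclidean_space set"
  assumes "closed T" and "negligible (S - T)"
  shows "interior S \<subseteq> interior T"
proof -
  have "open (interior S - T)" using assms(1) by blast
  moreover have "negligible (interior S - T)"
    using assms(2) by (rule negligible_subset) (use interior_subset in blast)
  ultimately have "interior S - T = {}"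
    using open_not_negligible by blast
  then show ?thesis by (intro interior_maximal) auto
qed

text \<open>This is where the centroid enters: an affine function sees only the volume and the first
  moment of \<open>E\<close>.\<close>

lemma integral_affine:
  fixes E :: "(real^'d) set"
  assumes "compact E" and "vol E \<noteq> 0"
  shows "(LINT x:E|lebesgue. a \<bullet> x + c) = vol E * (a \<bullet> centroid E + c)"
proof -
  have i: "set_integrable lebesgue E (\<lambda>x. x)" "set_integrable lebesgue E (\<lambda>x. a \<bullet> x)"
    "set_integrable lebesgue E (\<lambda>x. c)"
    by (intro set_integrable_continuous_compact assms continuous_intros)+
  have "(LINT x:E|lebesgue. a \<bullet> x) = a \<bullet> (LINT x:E|lebesgue. x)"
    using i(1) unfolding set_lebesgue_integral_def set_integrable_def
    by (simp flip: integral_inner_right)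
  also have "\<dots> = vol E * (a \<bullet> centroid E)"
    using assms(2) by (simp add: centroid_def)
  finally show ?thesis
    using lmeasurable_compact[OF assms(1)]
    by (simp only: set_integral_add(2)[OF i(2,3)]) (simp add: set_lebesgue_integral_def distrib_left)
qed

text \<open>Equality of cells is expressed modulo null sets together with equality of interiors,
  since closed cells may carry lower-dimensional pieces. The weights are arbitrary maximisers,
  chosen independently for \<open>X\<close> and \<open>Y\<close>.\<close>

theorem theorem6p3:
  fixes \<Omega> :: "(real^'d) set"
    and A :: "(real^'d^'d)^'n"
    and X Y B :: "(real^'d)^'n"
    and v wX wY :: "real^'n"
  assumes "CARD('d) \<ge> 2"
    and "\<Omega> \<noteq> {}" and "convex \<Omega>" and "bounded \<Omega>" and "\<Omega> = closure (interior \<Omega>)"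
    and "(v, B) \<in> admissible_data \<Omega>"
    and "\<And>i. sym_pos_def (A $ i)"
    and "X \<in> seeds" and "Y \<in> seeds"
    and "optimal_weights \<Omega> A X v wX" and "optimal_weights \<Omega> A Y v wY"
    and "\<And>i. centroid (Lag \<Omega> A X wX i) = B $ i"
    and "\<And>i. centroid (Lag \<Omega> A Y wY i) = B $ i"
  shows "\<forall>i. negligible (sym_diff (Lag \<Omega> A X wX i) (Lag \<Omega> A Y wY i)) \<and>
             interior (Lag \<Omega> A X wX i) = interior (Lag \<Omega> A Y wY i)"
proof -
  define pot where "pot = (\<lambda>(Z::(real^'d)^'n) (w::real^'n) i x. (anorm (A $ i) (x - Z $ i))\<^sup>2 - w $ i)"
  have Lag: "Lag \<Omega> A Z w i = cell \<Omega> (pot Z w) i" for Z w i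
    by (simp add: Lag_def cell_def pot_def)
  have comp: "compact \<Omega>"
    using assms(4,5) closed_closure compact_eq_bounded_closed by metis
  have v: "v $ i > 0" "(\<Sum>i\<in>UNIV. v $ i) = vol \<Omega>" for i
    using assms(6) by (auto simp: admissible_data_def volumes_def)
  have md: "min_diagram \<Omega> (pot Z w)" if Z: "Z \<in> seeds" for Z w
  proof
    show "continuous_on \<Omega> (pot Z w i)" for i
      unfolding pot_def by (intro continuous_on_diff continuous_on_anorm_power2 continuous_on_const assms)
  next
    fix i j :: 'n assume "i \<noteq> j"
    then have "negligible {x. pot Z w i x = pot Z w j x}"
      unfolding pot_def using Z assms(7) by (intro negligible_anisotropic_bisector) (auto simp: seeds_def)
    then show "negligible (cell \<Omega> (pot Z w) i \<inter> cell \<Omega> (pot Z w) j)"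
      by (rule negligible_subset) (auto simp: cell_eq)
  qed (rule comp)
  \<comment> \<open>The prescribed volumes are derived from optimality of the weights, not
    assumed.\<close>
  have vol: "vol (cell \<Omega> (pot Z w) i) = v $ i"
    if "Z \<in> seeds" and opt: "optimal_weights \<Omega> A Z v w" for Z w i
  proof -
    have "dual_objective \<Omega> A Z v w' \<le> dual_objective \<Omega> A Z v w" for w'
      using opt by (auto simp: optimal_weights_def is_arg_max_def not_less)
    then show ?thesis
      using md[OF that(1)] v(2) unfolding dual_objective_def Lag pot_def
      by (intro measure_cell_optimal) auto
  qed
  have closed: "closed (cell \<Omega> (pot Z w) i)" and compact: "compact (cell \<Omega> (pot Z w) i)"
    if "Z \<in> seeds" for Z w i
    using min_diagram.compact[OF md[OF that]] min_diagram.cont[OF md[OF that]]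
    by (auto intro!: compact_cell compact_imp_closed)
  have eq: "(LINT x:cell \<Omega> (pot X wX) i|lebesgue. pot X wX i x - pot Y wY i x)
    = (LINT x:cell \<Omega> (pot Y wY) i|lebesgue. pot X wX i x - pot Y wY i x)" for i
  proof -
    \<comment> \<open>The quadratic terms cancel because both potentials use the same
      \<open>A $ i\<close>. Both integrals then equal
      \<open>v $ i * (a \<bullet> B $ i + c)\<close>; positivity of \<open>v $ i\<close> gives the
      nonzero volume that \<open>integral_affine\<close> requires.\<close>
    define a c where "a = 2 *\<^sub>R (A $ i *v (Y $ i) - A $ i *v (X $ i))"
      and "c = X $ i \<bullet> (A $ i *v X $ i) - wX $ i - Y $ i \<bullet> (A $ i *v Y $ i) + wY $ i"
    have aff: "pot X wX i x - pot Y wY i x = a \<bullet> x + c" for x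
      by (simp add: pot_def a_def c_def anorm_diff_power2 assms(7) inner_diff_left inner_diff_right inner_commute)
    show ?thesis
      unfolding aff using v(1)[of i] assms(8-13)
      by (simp add: integral_affine compact vol Lag)
  qed
  have neg: "negligible (sym_diff (cell \<Omega> (pot X wX) i) (cell \<Omega> (pot Y wY) i))" for i
    by (intro cells_negligible_sym_diff md assms eq)
  then have "interior (cell \<Omega> (pot X wX) i) = interior (cell \<Omega> (pot Y wY) i)" for i
    using closed[OF assms(8)] closed[OF assms(9)]
    by (intro equalityI interior_subset_if_negligible_diff) (auto intro: negligible_subset)
  with neg show ?thesis unfolding Lag by blast
qed

end
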